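(* Let $t\in(0,1)$, $r=\sqrt{1-t^2}$, and let $\{\theta_k\}_{k\in\mathbb Z}\cup\{\alpha_k\}_{k\in\mathbb Z}$ be independent random variables, each uniformly distributed on the torus $\mathbb T=\mathbb R/2\pi\mathbb Z$. For $\lambda\in\mathbb T$, let $\gamma_1(\lambda)$ be the (almost surely constant) largest Lyapunov exponent of the ergodic linear dynamical system $\Psi(n,\omega)=\tau(\Phi(n,\omega))$ over $GL_4(\mathbb R)$ generated by the transfer matrices at spectral parameter $\lambda$. Then $\gamma_1(\lambda)>0$ for every $\lambda\in\mathbb T$.
   Context: For $\lambda\in\mathbb T$ put $\eta_k(\lambda)=\theta_k+\theta_{k-1}+\alpha_k-\alpha_{k-1}+\lambda$. The transfer matrices are $T(k)=T(\eta_{2k}(\lambda),\eta_{2k-1}(\lambda))\in GL_2(\mathbb C)$, $k\in\mathbb Z$, where, for $(x,y)\in\mathbb T^2$, $$T(x,y)=\begin{pmatrix} -e^{-iy} & \frac{ir}{t}\left(e^{-iy}-1\right)\\[2pt] \frac{ir}{t}\left(e^{i(x-y)}-e^{-iy}\right) & -\frac1{t^2}e^{ix}+\frac{r^2}{t^2}\left(e^{i(x-y)}+1-e^{-iy}\right)\end{pmatrix}.$$ For $n\ge1$, $\Phi(n,\omega)=T(n)\cdots T(2)T(1)$. The map $\tau:\mathcal M_2(\mathbb C)\to\mathcal M_4(\mathbb R)$ replaces each complex entry $a$ by the $2\times2$ real block $\Re(a)I+\Im(a)J$, with $I=\begin{pmatrix}1&0\\0&1\end{pmatrix}$, $J=\begin{pmatrix}0&1\\-1&0\end{pmatrix}$.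 The largest Lyapunov exponent is $\gamma_1(\lambda)=\lim_{n\to\infty}\frac1n\ln\|\Psi(n,\omega)\|$ (almost surely). *)

theory Defs
  imports "HOL-Probability.Probability"
begin

text \<open>
  The torus \<open>\<real>/2\<pi>\<int>\<close> is represented by real numbers: a random element of it by its
  representative in \<open>[0, 2\<pi>)\<close>, a fixed element by any real representative. Everything below
  depends on angles only through \<^const>\<open>cis\<close>, hence only on their classes modulo \<open>2\<pi>\<close>.
\<close>

definition uniform_torus :: "real measure" where
  "uniform_torus = uniform_measure lborel {0..<2 * pi}"

definition eta :: "(int \<Rightarrow> 'a \<Rightarrow> real) \<Rightarrow> (int \<Rightarrow> 'a \<Rightarrow> real) \<Rightarrow> real \<Rightarrow> int \<Rightarrow> 'a \<Rightarrow> real" where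
  "eta \<theta> \<alpha> l k \<omega> = \<theta> k \<omega> + \<theta> (k - 1) \<omega> + \<alpha> k \<omega> - \<alpha> (k - 1) \<omega> + l"

definition transfer_fun :: "real \<Rightarrow> real \<Rightarrow> real \<Rightarrow> real \<Rightarrow> complex^2^2" where
  "transfer_fun t r x y = vector
     [vector [- cis (- y),
              \<i> * of_real (r / t) * (cis (- y) - 1)],
      vector [\<i> * of_real (r / t) * (cis (x - y) - cis (- y)),
              - of_real (1 / t\<^sup>2) * cis x
                + of_real (r\<^sup>2 / t\<^sup>2) * (cis (x - y) + 1 - cis (- y))]]"

definition transfer_matrix ::
  "real \<Rightarrow> real \<Rightarrow> (int \<Rightarrow> 'a \<Rightarrow> real) \<Rightarrow> (int \<Rightarrow> 'a \<Rightarrow> real) \<Rightarrow> real \<Rightarrow> int \<Rightarrow> 'a \<Rightarrow> complex^2^2" where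
  "transfer_matrix t r \<theta> \<alpha> l k \<omega> =
     transfer_fun t r (eta \<theta> \<alpha> l (2 * k) \<omega>) (eta \<theta> \<alpha> l (2 * k - 1) \<omega>)"

primrec Phi ::
  "real \<Rightarrow> real \<Rightarrow> (int \<Rightarrow> 'a \<Rightarrow> real) \<Rightarrow> (int \<Rightarrow> 'a \<Rightarrow> real) \<Rightarrow> real \<Rightarrow> nat \<Rightarrow> 'a \<Rightarrow> complex^2^2" where
  "Phi t r \<theta> \<alpha> l 0 \<omega> = mat 1"
| "Phi t r \<theta> \<alpha> l (Suc n) \<omega> = transfer_matrix t r \<theta> \<alpha> l (int (Suc n)) \<omega> ** Phi t r \<theta> \<alpha> l n \<omega>"

text \<open>Each entry \<open>a\<close> becomes the block with rows \<open>(Re a, Im a)\<close> and \<open>(- Im a, Re a)\<close>.\<close>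

definition tau :: "complex^2^2 \<Rightarrow> real^4^4" where
  "tau A = vector
     [vector [  Re (A$1$1), Im (A$1$1),   Re (A$1$2), Im (A$1$2)],
      vector [- Im (A$1$1), Re (A$1$1), - Im (A$1$2), Re (A$1$2)],
      vector [  Re (A$2$1), Im (A$2$1),   Re (A$2$2), Im (A$2$2)],
      vector [- Im (A$2$1), Re (A$2$1), - Im (A$2$2), Re (A$2$2)]]"

definition Psi ::
  "real \<Rightarrow> real \<Rightarrow> (int \<Rightarrow> 'a \<Rightarrow> real) \<Rightarrow> (int \<Rightarrow> 'a \<Rightarrow> real) \<Rightarrow> real \<Rightarrow> nat \<Rightarrow> 'a \<Rightarrow> real^4^4" where
  "Psi t r \<theta> \<alpha> l n \<omega> = tau (Phi t r \<theta> \<alpha> l n \<omega>)"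

text \<open>
  The matrix norm is the Euclidean operator norm; the limit is the same for every matrix norm.
  The description operator only picks out a meaningful number if the almost sure limit exists
  and is constant, which therefore has to be asserted wherever this constant is used.
\<close>

definition has_largest_lyapunov_exponent ::
  "'a measure \<Rightarrow> (nat \<Rightarrow> 'a \<Rightarrow> real^4^4) \<Rightarrow> real \<Rightarrow> bool" where
  "has_largest_lyapunov_exponent M \<Psi> \<gamma> \<longleftrightarrow>
     (AE \<omega> in M. (\<lambda>n. 1 / real n * ln (onorm ((*v) (\<Psi> n \<omega>)))) \<longlonglongrightarrow> \<gamma>)"

definition largest_lyapunov_exponent ::
  "'a measure \<Rightarrow> (nat \<Rightarrow> 'a \<Rightarrow> real^4^4) \<Rightarrow> real" where
  "largest_lyapunov_exponent M \<Psi> = (THE \<gamma>. has_largest_lyapunov_exponent M \<Psi> \<gamma>)"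

lemma (in prob_space) largest_lyapunov_exponent_eqI:
  assumes "has_largest_lyapunov_exponent M \<Psi> \<gamma>"
  shows "largest_lyapunov_exponent M \<Psi> = \<gamma>"
  unfolding largest_lyapunov_exponent_def
proof (rule the_equality)
  fix \<gamma>' assume "has_largest_lyapunov_exponent M \<Psi> \<gamma>'"
  with assms have "AE \<omega> in M. \<gamma>' = \<gamma>"
    unfolding has_largest_lyapunov_exponent_def
    by eventually_elim (rule LIMSEQ_unique)
  then show "\<gamma>' = \<gamma>" by simp
qed (fact assms)

lemma det_transfer_fun:
  assumes "0 < t" "t < 1" "r = sqrt (1 - t\<^sup>2)"
  shows "det (transfer_fun t r x y) = cis (x - y)"
proof -
  have r2: "r\<^sup>2 = 1 - t\<^sup>2" using assms by (simp add: abs_square_le_1)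
  have e: "cis (x - y) = cis x * cis (- y)" by (simp add: cis_mult)
  have "det (transfer_fun t r x y) =
      of_real (1 / t\<^sup>2 - r\<^sup>2 / t\<^sup>2) * (cis x * cis (- y))"
    unfolding det_2 transfer_fun_def e
    by (simp add: field_simps power2_eq_square) (simp flip: add_divide_distrib)
  also have "1 / t\<^sup>2 - r\<^sup>2 / t\<^sup>2 = 1"
    using assms(1) by (simp add: r2 diff_divide_distrib[symmetric])
  finally show ?thesis by (simp add: e)
qed

lemma vector_4:
  "(vector [w, x, y, z] :: 'a::zero^4) $ 1 = w"
  "(vector [w, x, y, z] :: 'a::zero^4) $ 2 = x"
  "(vector [w, x, y, z] :: 'a::zero^4) $ 3 = y"
  "(vector [w, x, y, z] :: 'a::zero^4) $ 4 = z"
  unfolding vector_def by simp_all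

lemma tau_matrix_mult: "tau (A ** B) = tau A ** tau B"
  by (simp add: vec_eq_iff forall_4 tau_def matrix_matrix_mult_def sum_2 sum_4 vector_4 algebra_simps)

end

theory Submission
  imports Defs "HOL-Complex_Analysis.Complex_Analysis"
begin

text \<open>
  The transfer matrices preserve an indefinite Hermitian form, so they map isotropic vectors
  to isotropic vectors, and the isotropic lines form a circle. In the coordinate \<open>z\<close> of this circle
  the matrix \<open>T(x, y)\<close> is \<open>h \<circ> (rotation by x) \<circ> h \<circ> (rotation by y)\<close> for one fixed
  Moebius transformation \<open>h\<close>, and each application of \<open>h\<close> at the point \<open>z\<close> multiplies the length
  by \<open>\<bar>1 - i r z\<bar> / t\<close> (up to bounded factors). Since each rotation contains a fresh uniform
  angle \<open>\<theta>\<close>, the points at which \<open>h\<close> is applied are uniform and each is independent of the past.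
  The strong law of large numbers then gives the growth rate per application of \<open>h\<close>, which is the
  circle average of \<open>ln (\<bar>1 - i r z\<bar> / t)\<close>, namely \<open>ln (1 / t)\<close> by the mean value property.
  As two isotropic vectors span the plane, the exponent is \<open>2 ln (1 / t) > 0\<close>.
\<close>

section \<open>A strong law of large numbers\<close>

context prob_space
begin

text \<open>Hoeffding's lemma on the interval from \<open>- c\<close> to \<open>c\<close>: its
  length \<open>2 * c\<close> enters as \<open>(2 * c)^2 / 8\<close>.\<close>

lemma expectation_exp_le_of_bounded_centered:
  fixes X :: "'a \<Rightarrow> real"
  assumes [measurable]: "random_variable borel X"
    and bd: "\<And>\<omega>. \<omega> \<in> space M \<Longrightarrow> \<bar>X \<omega>\<bar> \<le> c" and "expectation X = 0" and "0 < s"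
  shows "expectation (\<lambda>\<omega>. exp (s * X \<omega>)) \<le> exp (s\<^sup>2 * c\<^sup>2 / 2)"
proof -
  interpret interval_bounded_random_variable M X "- c" c
    by standard (use bd in \<open>auto intro!: AE_I2 simp: abs_le_iff minus_le_iff\<close>)
  have "(\<integral>\<^sup>+\<omega>. exp (s * X \<omega>) \<partial>M) \<le> ennreal (exp (s\<^sup>2 * (c - - c)\<^sup>2 / 8))"
    using assms by (intro Hoeffdings_lemma_nn_integral_0)
  also have "s\<^sup>2 * (c - - c)\<^sup>2 / 8 = s\<^sup>2 * c\<^sup>2 / 2"
    by (simp add: power2_eq_square)
  finally show ?thesis
    by (intro integral_real_bounded) auto
qed

text \<open>Chernoff bound and Borel-Cantelli. Independence of \<open>X n\<close> from the preceding
  partial sum makes the moment generating function of the sum factor one term at a time, so the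
  probability that the average exceeds \<open>e\<close> decays geometrically. The hypothesis has
  this form because each gain will be shown independent of the sum of the earlier ones.\<close>

lemma AE_eventually_average_less:
  fixes X :: "nat \<Rightarrow> 'a \<Rightarrow> real"
  assumes [measurable]: "\<And>n. random_variable borel (X n)"
    and bd: "\<And>n \<omega>. \<omega> \<in> space M \<Longrightarrow> \<bar>X n \<omega>\<bar> \<le> c"
    and mean: "\<And>n. expectation (X n) = 0"
    and ind: "\<And>n. indep_var borel (\<lambda>\<omega>. \<Sum>k<n. X k \<omega>) borel (X n)"
    and "0 < e"
  shows "AE \<omega> in M. \<forall>\<^sub>F n in sequentially. (\<Sum>k<n. X k \<omega>) / real n < e"
proof -
  \<comment> \<open>A positive bound, so that dividing by its square is safe.\<close>
  define d where "d = max c 1"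
  have d: "d > 0" "\<And>n \<omega>. \<omega> \<in> space M \<Longrightarrow> \<bar>X n \<omega>\<bar> \<le> d"
    using order.trans[OF bd max.cobounded1] by (auto simp: d_def)
  \<comment> \<open>This value minimises the Chernoff exponent \<open>s^2 * d^2 / 2 - s * e\<close>;
    the minimum is \<open>- e^2 / (2 * d^2)\<close>.\<close>
  define s where "s = e / d\<^sup>2"
  have s: "s > 0" using d(1) \<open>0 < e\<close> by (simp add: s_def)
  define S where "S n \<omega> = (\<Sum>k<n. X k \<omega>)" for n \<omega>
  have [measurable]: "S n \<in> borel_measurable M" for n
    unfolding S_def by measurable
  have S_bd: "S n \<omega> \<le> n * d" if "\<omega> \<in> space M" for n \<omega>
    unfolding S_def using sum_bounded_above[of "{..<n}" "\<lambda>k. X k \<omega>" d] d(2)[OF that]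
    by (simp add: abs_le_iff)
  have int_S: "integrable M (\<lambda>\<omega>. exp (s * S n \<omega>))" for n
    by (rule integrable_const_bound[where B="exp (s * (n * d))"])
       (use S_bd s in \<open>auto intro!: AE_I2\<close>)
  have int_X: "integrable M (\<lambda>\<omega>. exp (s * X n \<omega>))" for n
    by (rule integrable_const_bound[where B="exp (s * d)"])
       (use d(2) s in \<open>auto intro!: AE_I2 simp: abs_le_iff\<close>)
  have mgf: "expectation (\<lambda>\<omega>. exp (s * S n \<omega>)) \<le> exp (s\<^sup>2 * d\<^sup>2 / 2) ^ n" for n
  proof (induction n)
    case 0
    show ?case by (simp add: S_def prob_space)
  next
    case (Suc n)
    have "indep_var borel ((\<lambda>x. exp (s * x)) \<circ> S n) borel ((\<lambda>x. exp (s * x)) \<circ> X n)"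
      using ind[of n] unfolding S_def[abs_def] by (rule indep_var_compose) auto
    then have "expectation (\<lambda>\<omega>. exp (s * S n \<omega>) * exp (s * X n \<omega>)) =
        expectation (\<lambda>\<omega>. exp (s * S n \<omega>)) * expectation (\<lambda>\<omega>. exp (s * X n \<omega>))"
      by (intro indep_var_lebesgue_integral int_S int_X) (simp add: o_def)
    also have "\<dots> \<le> exp (s\<^sup>2 * d\<^sup>2 / 2) ^ n * exp (s\<^sup>2 * d\<^sup>2 / 2)"
      using d(2) mean s
      by (intro mult_mono Suc expectation_exp_le_of_bounded_centered) auto
    finally show ?case
      by (simp add: S_def ring_distribs exp_add mult.commute)
  qed
  define A where "A n = {\<omega> \<in> space M. S n \<omega> \<ge> n * e}" for n
  have [measurable]: "A n \<in> sets M" for n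
    unfolding A_def by measurable
  have prob_A: "prob (A n) \<le> exp (- (e\<^sup>2 / (2 * d\<^sup>2))) ^ n" for n
  proof -
    have "prob (A n) \<le> exp (- s * (n * e)) * (\<integral>\<omega>\<in>space M. exp (s * S n \<omega>) \<partial>M)"
      unfolding A_def using int_S s
      by (intro Chernoff_ineq_ge)
         (auto simp: set_integrable_def intro!: integrable_mult_indicator[where 'b=real, unfolded real_scaleR_def])
    also have "(\<integral>\<omega>\<in>space M. exp (s * S n \<omega>) \<partial>M) = expectation (\<lambda>\<omega>. exp (s * S n \<omega>))"
      by (rule set_integral_space[OF int_S])
    also have "exp (- s * (n * e)) * \<dots> \<le> exp (- s * (n * e)) * exp (s\<^sup>2 * d\<^sup>2 / 2) ^ n"
      by (intro mult_left_mono mgf) auto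
    also have "\<dots> = exp (n * (s\<^sup>2 * d\<^sup>2 / 2 - s * e))"
      by (simp add: exp_add[symmetric] exp_of_nat_mult[symmetric] algebra_simps)
    also have "s\<^sup>2 * d\<^sup>2 / 2 - s * e = - (e\<^sup>2 / (2 * d\<^sup>2))"
      using d(1) by (simp add: s_def power2_eq_square field_simps)
    finally show ?thesis by (simp add: exp_of_nat_mult[symmetric])
  qed
  have "summable (\<lambda>n. exp (- (e\<^sup>2 / (2 * d\<^sup>2))) ^ n)"
    using \<open>0 < e\<close> d(1) by (intro summable_geometric) simp
  then have summ: "summable (\<lambda>n. prob (A n))"
    by (rule summable_comparison_test'[where N=0]) (simp add: prob_A)
  have "AE \<omega> in M. \<forall>\<^sub>F n in sequentially. \<omega> \<in> space M - A n"
    by (rule borel_cantelli_AE1) (simp_all add: summ emeasure_eq_measure)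
  then show ?thesis
  proof eventually_elim
    case (elim \<omega>)
    with eventually_gt_at_top[of 0] show ?case
      by eventually_elim (auto simp: A_def S_def field_simps)
  qed
qed

text \<open>The one-sided bound is applied to \<open>X\<close> and to \<open>- X\<close>. Tolerances
  \<open>1 / (m + 1)\<close> suffice, so only countably many null sets are discarded.\<close>

lemma AE_average_tendsto_0:
  fixes X :: "nat \<Rightarrow> 'a \<Rightarrow> real"
  assumes [measurable]: "\<And>n. random_variable borel (X n)"
    and bd: "\<And>n \<omega>. \<omega> \<in> space M \<Longrightarrow> \<bar>X n \<omega>\<bar> \<le> c"
    and mean: "\<And>n. expectation (X n) = 0"
    and ind: "\<And>n. indep_var borel (\<lambda>\<omega>. \<Sum>k<n. X k \<omega>) borel (X n)"
  shows "AE \<omega> in M. (\<lambda>n. (\<Sum>k<n. X k \<omega>) / real n) \<longlonglongrightarrow> 0"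
proof -
  have ind': "indep_var borel (\<lambda>\<omega>. \<Sum>k<n. - X k \<omega>) borel (\<lambda>\<omega>. - X n \<omega>)" for n
    using indep_var_compose[OF ind, of uminus borel uminus borel n]
    by (simp add: o_def sum_negf)
  have "AE \<omega> in M. \<forall>m. \<forall>\<^sub>F n in sequentially. (\<Sum>k<n. X k \<omega>) / real n < 1 / real (Suc m)"
    unfolding AE_all_countable
    using assms by (intro allI AE_eventually_average_less[where c=c]) auto
  moreover have "AE \<omega> in M. \<forall>m. \<forall>\<^sub>F n in sequentially. (\<Sum>k<n. - X k \<omega>) / real n < 1 / real (Suc m)"
    unfolding AE_all_countable
    using assms ind' by (intro allI AE_eventually_average_less[where c=c]) auto
  ultimately show ?thesis
  proof eventually_elim
    case (elim \<omega>)
    show ?case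
    proof (rule tendstoI)
      fix e :: real assume "e > 0"
      then obtain m where m: "1 / real (Suc m) < e"
        using nat_approx_posE by blast
      from elim(1)[rule_format, of m] elim(2)[rule_format, of m]
      show "\<forall>\<^sub>F n in sequentially. dist ((\<Sum>k<n. X k \<omega>) / real n) 0 < e"
        by eventually_elim (use m in \<open>auto simp: sum_negf abs_less_iff\<close>)
    qed
  qed
qed

end

section \<open>Transfer matrices on isotropic vectors\<close>

text \<open>This is the action of the matrix with rows \<open>(1, - i r)\<close> and
  \<open>(- i r, - 1)\<close> on the coordinate \<open>z\<close> of the line through
  \<open>(1, z)\<close>. The denominator is the first coordinate of the image of
  \<open>(1, z)\<close>, hence its role as the gain.\<close>

definition moebius :: "real \<Rightarrow> complex \<Rightarrow> complex" where
  "moebius r z = - (z + \<i> * of_real r) / (1 - \<i> * of_real r * z)"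

text \<open>Angles are numbered from 0, so the direction at \<open>n\<close> does not see
  \<open>e n\<close>; this leaves the rotation at step \<open>n\<close> free to bring in new
  randomness.\<close>

primrec direction :: "real \<Rightarrow> complex \<Rightarrow> (nat \<Rightarrow> real) \<Rightarrow> nat \<Rightarrow> complex" where
  "direction r \<zeta> e 0 = \<zeta>"
| "direction r \<zeta> e (Suc n) = moebius r (cis (e n) * direction r \<zeta> e n)"

lemma one_minus_r_le_gain:
  assumes "0 \<le> r" "norm z = 1"
  shows "1 - r \<le> norm (1 - \<i> * of_real r * z)"
  using norm_triangle_ineq2[of 1 "\<i> * of_real r * z"] assms by (simp add: norm_mult)

lemma gain_le_one_plus_r:
  assumes "0 \<le> r" "norm z = 1"
  shows "norm (1 - \<i> * of_real r * z) \<le> 1 + r"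
  using norm_triangle_ineq4[of 1 "\<i> * of_real r * z"] assms by (simp add: norm_mult)

text \<open>On the unit circle the numerator is \<open>z\<close> times the complex conjugate of the
  denominator, up to sign, so both have the same modulus.\<close>

lemma norm_moebius:
  assumes r: "0 \<le> r" "r < 1" and z: "norm z = 1"
  shows "norm (moebius r z) = 1"
proof -
  have "z * cnj z = 1"
    using z by (simp add: complex_norm_square[symmetric])
  then have "z + \<i> * of_real r = z * cnj (1 - \<i> * of_real r * z)"
    by (simp add: algebra_simps)
  then have "norm (z + \<i> * of_real r) = norm (1 - \<i> * of_real r * z)"
    using z by (metis complex_mod_cnj mult_1 norm_mult)
  moreover have "1 - \<i> * of_real r * z \<noteq> 0"
    using one_minus_r_le_gain[OF r(1) z] r by auto
  ultimately show ?thesis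
    by (simp add: moebius_def norm_divide norm_minus_commute norm_minus_cancel[symmetric, of "- z - _"] add.commute del: norm_minus_cancel)
qed

lemma norm_direction:
  assumes "0 \<le> r" "r < 1" "norm \<zeta> = 1"
  shows "norm (direction r \<zeta> e n) = 1"
  by (induction n) (use assms in \<open>auto simp: norm_mult intro!: norm_moebius\<close>)

lemma direction_cong:
  assumes "\<And>k. k < n \<Longrightarrow> e k = e' k"
  shows "direction r \<zeta> e n = direction r \<zeta> e' n"
  using assms by (induction n) auto

definition log_gain :: "real \<Rightarrow> real \<Rightarrow> complex \<Rightarrow> real" where
  "log_gain t r z = ln (norm (1 - \<i> * of_real r * z) / t)"

lemma exp_log_gain:
  assumes "0 < t" "0 \<le> r" "r < 1" "norm z = 1"
  shows "exp (log_gain t r z) = norm (1 - \<i> * of_real r * z) / t"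
  unfolding log_gain_def using one_minus_r_le_gain[OF assms(2,4)] assms(1,3)
  by (intro exp_ln divide_pos_pos) linarith+

definition total_log_gain :: "real \<Rightarrow> real \<Rightarrow> complex \<Rightarrow> (nat \<Rightarrow> real) \<Rightarrow> nat \<Rightarrow> real" where
  "total_log_gain t r \<zeta> e n = (\<Sum>k<n. log_gain t r (cis (e k) * direction r \<zeta> e k))"

text \<open>As \<open>r < 1\<close>, the gain stays away from zero on the circle. This uniform bound
  is what the law of large numbers above asks for.\<close>

lemma abs_log_gain_le:
  assumes "0 < t" "0 \<le> r" "r < 1" "norm z = 1"
  shows "\<bar>log_gain t r z\<bar> \<le> \<bar>ln ((1 - r) / t)\<bar> + \<bar>ln ((1 + r) / t)\<bar>"
proof -
  have "ln ((1 - r) / t) \<le> log_gain t r z"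
    using one_minus_r_le_gain[of r z] assms unfolding log_gain_def
    by (intro ln_mono divide_right_mono divide_pos_pos) auto
  moreover have "log_gain t r z \<le> ln ((1 + r) / t)"
    using one_minus_r_le_gain[of r z] gain_le_one_plus_r[of r z] assms unfolding log_gain_def
    by (intro ln_mono divide_right_mono divide_pos_pos) auto
  ultimately show ?thesis by linarith
qed

definition isotropic :: "real \<Rightarrow> real \<Rightarrow> complex \<Rightarrow> complex^2" where
  "isotropic t r z = vector [- 1 + \<i> * of_real r * z, of_real t * z]"

text \<open>
  After changing to the basis \<open>(- 1, 0)\<close>, \<open>(i r, t)\<close> the matrix \<open>T(x, y)\<close> becomes
  \<open>- cis (- y) N D(x) N D(y)\<close> with \<open>D(x) = diag (1, cis x)\<close> and \<open>N\<close> equal to \<open>1 / t\<close> times the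
  matrix with rows \<open>(1, - i r)\<close> and \<open>(- i r, - 1)\<close>; \<open>isotropic t r z\<close> has coordinates \<open>(1, z)\<close>.
\<close>

lemma vec2_eq_iff: "v = w \<longleftrightarrow> v $ 1 = w $ 1 \<and> v $ 2 = w $ 2" for v w :: "'a^2"
  by (simp add: vec_eq_iff forall_2)

lemma transfer_fun_isotropic:
  fixes t r x y :: real and z :: complex
  assumes t: "0 < t" "t < 1" "r = sqrt (1 - t\<^sup>2)" and z: "norm z = 1"
  defines "z1 \<equiv> cis y * z"
  defines "z2 \<equiv> cis x * moebius r z1"
  shows "transfer_fun t r x y *v isotropic t r z =
    (- cis (- y) * ((1 - \<i> * of_real r * z1) / of_real t) * ((1 - \<i> * of_real r * z2) / of_real t))
      *s isotropic t r (moebius r z2)"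
proof -
  have r: "0 \<le> r" "r < 1"
    using t by (auto simp: real_sqrt_lt_1_iff power_le_one)
  define a b ct cr where "a = cis y" and "b = cis x"
    and "ct = complex_of_real t" and "cr = complex_of_real r"
  have n1: "norm z1 = 1" unfolding z1_def using z by (simp add: norm_mult)
  have n2: "norm z2 = 1" unfolding z2_def using norm_moebius[OF r n1] by (simp add: norm_mult)
  have nz: "1 - \<i> * cr * z1 \<noteq> 0" "1 - \<i> * cr * z2 \<noteq> 0"
    unfolding cr_def using one_minus_r_le_gain[OF r(1) n1] one_minus_r_le_gain[OF r(1) n2] r by auto
  have a: "a \<noteq> 0" "cis (- y) = 1 / a" "cis (x - y) = b / a"
    unfolding a_def b_def by (simp_all add: cis_divide[of 0 y, simplified] cis_divide)
  have ct: "ct \<noteq> 0" using t by (simp add: ct_def)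
  have "r\<^sup>2 = 1 - t\<^sup>2" using t by (simp add: abs_square_le_1)
  then have ct2: "ct * ct = 1 - cr * cr"
    unfolding cr_def ct_def power2_eq_square by (metis add_diff_cancel_left' diff_add_cancel of_real_1 of_real_diff of_real_mult)
  have ii: "\<i> * (\<i> * w) = - w" for w by (simp add: mult.assoc[symmetric])
  have zz: "z = z1 / a" using a by (simp add: z1_def a_def)
  \<comment> \<open>Here and in \<open>m2\<close> the denominators of \<open>moebius\<close> are
    cleared, so that no Moebius quotient survives in the two coordinate identities below.\<close>
  have z2: "(1 - \<i> * cr * z1) * z2 = - b * (z1 + \<i> * cr)"
    using nz unfolding z2_def moebius_def b_def cr_def by (simp add: field_simps)
  have m2: "(1 - \<i> * cr * z2) * moebius r z2 = - (z2 + \<i> * cr)"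
    using nz unfolding moebius_def cr_def by simp
  \<comment> \<open>The terms with \<open>z2\<close> cancel and \<open>r^2 + t^2 = 1\<close> does
    the rest. This matches the first row of the matrix, which does not contain
    \<open>x\<close>.\<close>
  have iso1: "(1 - \<i> * cr * z2) * (- 1 + \<i> * cr * moebius r z2) = - (ct * ct)"
  proof -
    have "(1 - \<i> * cr * z2) * (- 1 + \<i> * cr * moebius r z2)
        = - (1 - \<i> * cr * z2) + \<i> * cr * ((1 - \<i> * cr * z2) * moebius r z2)"
      by (simp add: algebra_simps)
    also have "\<dots> = - (ct * ct)"
      unfolding m2 ct2 by (simp add: algebra_simps)
    finally show ?thesis .
  qed
  have 1: "- (1 / a) * (- 1 + \<i> * cr * z) + \<i> * (cr / ct) * (1 / a - 1) * (ct * z) =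
      - (1 / a) * ((1 - \<i> * cr * z1) / ct) * ((1 - \<i> * cr * z2) / ct) * (- 1 + \<i> * cr * moebius r z2)"
  proof -
    have "- (1 / a) * ((1 - \<i> * cr * z1) / ct) * ((1 - \<i> * cr * z2) / ct) * (- 1 + \<i> * cr * moebius r z2)
      = - (1 / a) * (1 - \<i> * cr * z1) / (ct * ct) * ((1 - \<i> * cr * z2) * (- 1 + \<i> * cr * moebius r z2))"
      by (simp add: mult.assoc)
    also have "\<dots> = (1 / a) * (1 - \<i> * cr * z1)"
      unfolding iso1 using ct by simp
    also have "\<dots> = - (1 / a) * (- 1 + \<i> * cr * z) + \<i> * (cr / ct) * (1 / a - 1) * (ct * z)"
      unfolding zz using ct a(1) by (simp add: field_simps)
    finally show ?thesis ..
  qed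
  have 2: "\<i> * (cr / ct) * (b / a - 1 / a) * (- 1 + \<i> * cr * z)
        + (- (1 / (ct * ct)) * b + cr * cr / (ct * ct) * (b / a + 1 - 1 / a)) * (ct * z) =
      - (1 / a) * ((1 - \<i> * cr * z1) / ct) * ((1 - \<i> * cr * z2) / ct) * (ct * moebius r z2)"
  proof -
    have "- (1 / a) * ((1 - \<i> * cr * z1) / ct) * ((1 - \<i> * cr * z2) / ct) * (ct * moebius r z2)
      = - (1 / a) * (1 - \<i> * cr * z1) / ct * ((1 - \<i> * cr * z2) * moebius r z2)"
      using ct by simp
    also have "\<dots> = (1 / (a * ct)) * ((1 - \<i> * cr * z1) * z2 + (1 - \<i> * cr * z1) * \<i> * cr)"
      unfolding m2 using ct a(1) by (simp add: field_simps)
    also have "\<dots> = (1 / (a * ct)) * (- b * (z1 + \<i> * cr) + \<i> * cr + cr * cr * z1)"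
      unfolding z2 by (simp add: algebra_simps)
    also have "\<dots> = (1 / (a * ct)) * (\<i> * cr * (b - 1) * (- 1 + \<i> * cr * z) + (- b * a + cr * cr * (b + a - 1)) * z)"
      unfolding zz using a(1) by (simp add: algebra_simps ii)
    also have "\<dots> = \<i> * (cr / ct) * (b / a - 1 / a) * (- 1 + \<i> * cr * z)
        + (- (1 / (ct * ct)) * b + cr * cr / (ct * ct) * (b / a + 1 - 1 / a)) * (ct * z)"
      using ct a(1) by (simp add: field_simps)
    finally show ?thesis ..
  qed
  show ?thesis
    using 1 2 unfolding vec2_eq_iff
    by (simp add: transfer_fun_def isotropic_def matrix_vector_mult_def sum_2 a power2_eq_square
        flip: ct_def cr_def b_def)
qed

section \<open>The real form \<open>tau\<close> and the operator norm\<close>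

definition conj_embed :: "complex^2 \<Rightarrow> real^4" where
  "conj_embed v = vector [Re (v$1), - Im (v$1), Re (v$2), - Im (v$2)]"

lemma norm_conj_embed: "norm (conj_embed v) = norm v"
  by (simp add: norm_vec_def L2_set_def sum_4 sum_2 conj_embed_def vector_4 cmod_power2 add_ac)

lemma surj_conj_embed: "\<exists>v. w = conj_embed v"
proof
  show "w = conj_embed (vector [Complex (w$1) (- w$2), Complex (w$3) (- w$4)])"
    by (simp add: vec_eq_iff forall_4 conj_embed_def vector_4)
qed

text \<open>Under the usual identification of the plane with the complex numbers, \<open>J\<close>
  is multiplication by \<open>- i\<close>, so the block of \<open>a\<close> multiplies by the
  conjugate of \<open>a\<close>. Storing conjugated coordinates turns this into multiplication by
  \<open>a\<close>.\<close>

lemma tau_conj_embed: "tau A *v conj_embed v = conj_embed (A *v v)"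
  by (simp add: vec_eq_iff forall_4 conj_embed_def tau_def vector_4 matrix_vector_mult_def
      sum_4 sum_2 algebra_simps)

lemma norm_le_onorm_tau: "norm (A *v v) \<le> onorm ((*v) (tau A)) * norm v"
  using onorm[OF matrix_vector_mul_bounded_linear, of "tau A" "conj_embed v"]
  by (simp add: tau_conj_embed norm_conj_embed)

lemma onorm_tau_le:
  assumes "\<And>v. norm (A *v v) \<le> b * norm v"
  shows "onorm ((*v) (tau A)) \<le> b"
proof (rule onorm_le)
  fix w :: "real^4"
  obtain v where "w = conj_embed v" using surj_conj_embed by blast
  then show "norm (tau A *v w) \<le> b * norm w"
    using assms[of v] by (simp add: tau_conj_embed norm_conj_embed)
qed

section \<open>From growth of two isotropic vectors to growth of the matrix norm\<close>

lemma norm_isotropic_ge: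
  assumes "0 < t" "norm z = 1"
  shows "t \<le> norm (isotropic t r z)"
  using Finite_Cartesian_Product.norm_nth_le[of "isotropic t r z" 2] assms
  by (simp add: isotropic_def norm_mult)

lemma norm_isotropic_le:
  assumes "0 < t" "t < 1" "0 \<le> r" "r < 1" "norm z = 1"
  shows "norm (isotropic t r z) \<le> 3"
proof -
  have "norm (isotropic t r z) \<le> norm (- 1 + \<i> * of_real r * z) + norm (of_real t * z)"
    unfolding norm_vec_def
    by (rule order.trans[OF L2_set_le_sum]) (auto simp: sum_2 isotropic_def)
  also have "\<dots> \<le> (1 + r) + t"
    using gain_le_one_plus_r[of r z] assms by (simp add: norm_mult norm_minus_commute)
  finally show ?thesis using assms by linarith
qed

lemma isotropic_span:
  assumes t: "0 < t" "t < 1" and r: "0 \<le> r" "r < 1"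
  obtains c d where "v = c *s isotropic t r 1 + d *s isotropic t r (- 1)"
    and "norm c \<le> 2 / t * norm v" "norm d \<le> 2 / t * norm v"
proof
  \<comment> \<open>In the basis \<open>(- 1, 0)\<close>, \<open>(i r, t)\<close> the vector
    \<open>v\<close> has coordinates \<open>i r v$2 / t - v$1\<close> and \<open>v$2 / t\<close>,
    while the two isotropic vectors have coordinates \<open>(1, 1)\<close> and
    \<open>(1, - 1)\<close>. So \<open>c\<close> and \<open>d\<close> are the half sum and the half
    difference.\<close>
  define c where "c = (\<i> * of_real r * v$2 / of_real t - v$1 + v$2 / of_real t) / 2"
  define d where "d = (\<i> * of_real r * v$2 / of_real t - v$1 - v$2 / of_real t) / 2"
  show "v = c *s isotropic t r 1 + d *s isotropic t r (- 1)"
    using t by (simp add: vec2_eq_iff isotropic_def c_def d_def field_simps)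
  define w1 w2 where "w1 = norm (v$1)" and "w2 = norm (v$2)"
  have v: "w1 \<le> norm v" "w2 \<le> norm v" "0 \<le> w1" "0 \<le> w2"
    unfolding w1_def w2_def using Finite_Cartesian_Product.norm_nth_le by auto
  have "r * w2 / t \<le> norm v / t" "w2 / t \<le> norm v / t"
    using v t r mult_mono[of r 1 w2 "norm v"] by (auto intro!: divide_right_mono)
  moreover have "w1 \<le> norm v / t"
    using v t mult_mono[of w1 "norm v" t 1] by (simp add: field_simps)
  moreover have "norm c \<le> (r * w2 / t + w1 + w2 / t) / 2" "norm d \<le> (r * w2 / t + w1 + w2 / t) / 2"
    unfolding c_def d_def w1_def w2_def norm_divide using t r
    by (auto intro!: divide_right_mono order.trans[OF norm_triangle_ineq] order.trans[OF norm_triangle_ineq4]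
        add_mono simp: norm_mult norm_divide)
  moreover have "0 \<le> norm v / t" using t by simp
  ultimately have "norm c \<le> 2 * (norm v / t) \<and> norm d \<le> 2 * (norm v / t)"
    by auto
  then show "norm c \<le> 2 / t * norm v" "norm d \<le> 2 / t * norm v"
    by simp_all
qed

lemma norm_smult_cart: "norm (c *s v) = norm c * norm v" for v :: "'a::real_normed_field^'n"
  by (simp add: norm_vec_def norm_mult L2_set_right_distrib)

text \<open>Each matrix consumes two angles, whence \<open>2 * n\<close>. The matrix of index
  \<open>n + 1\<close> rotates first by \<open>e (2 * n)\<close>, its argument \<open>y\<close>, and
  then by \<open>e (2 * n + 1)\<close>, its argument \<open>x\<close>. Phases are collected in
  \<open>c\<close> and do not affect its modulus.\<close>

lemma Phi_isotropic:
  fixes \<theta> \<alpha> :: "int \<Rightarrow> 'a \<Rightarrow> real" and l :: real and \<omega> :: 'a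
  assumes t: "0 < t" "t < 1" "r = sqrt (1 - t\<^sup>2)" and \<zeta>: "norm \<zeta> = 1"
  defines "e \<equiv> \<lambda>k. eta \<theta> \<alpha> l (int k + 1) \<omega>"
  obtains c where "norm c = exp (total_log_gain t r \<zeta> e (2 * n))"
    and "Phi t r \<theta> \<alpha> l n \<omega> *v isotropic t r \<zeta> = c *s isotropic t r (direction r \<zeta> e (2 * n))"
proof -
  have r: "0 \<le> r" "r < 1"
    using t by (auto simp: real_sqrt_lt_1_iff power_le_one)
  have "\<exists>c. norm c = exp (total_log_gain t r \<zeta> e (2 * n)) \<and>
    Phi t r \<theta> \<alpha> l n \<omega> *v isotropic t r \<zeta> = c *s isotropic t r (direction r \<zeta> e (2 * n))"
  proof (induction n)
    case 0
    show ?case by (auto simp: total_log_gain_def intro!: exI[of _ 1])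
  next
    case (Suc n)
    then obtain c where c: "norm c = exp (total_log_gain t r \<zeta> e (2 * n))"
      "Phi t r \<theta> \<alpha> l n \<omega> *v isotropic t r \<zeta> = c *s isotropic t r (direction r \<zeta> e (2 * n))"
      by blast
    define z1 where "z1 = cis (e (2 * n)) * direction r \<zeta> e (2 * n)"
    define z2 where "z2 = cis (e (Suc (2 * n))) * moebius r z1"
    define b where "b = - cis (- e (2 * n)) * ((1 - \<i> * of_real r * z1) / of_real t)
      * ((1 - \<i> * of_real r * z2) / of_real t)"
    have z: "norm z1 = 1" "norm z2 = 1"
      unfolding z1_def z2_def
      using norm_direction[OF r \<zeta>] norm_moebius[OF r] by (auto simp: norm_mult)
    have "Phi t r \<theta> \<alpha> l (Suc n) \<omega> *v isotropic t r \<zeta>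
        = transfer_matrix t r \<theta> \<alpha> l (int (Suc n)) \<omega> *v (c *s isotropic t r (direction r \<zeta> e (2 * n)))"
      by (simp add: matrix_vector_mul_assoc[symmetric] c)
    also have "\<dots> = c *s (transfer_fun t r (e (Suc (2 * n))) (e (2 * n)) *v isotropic t r (direction r \<zeta> e (2 * n)))"
      by (simp add: vector_scalar_commute transfer_matrix_def e_def algebra_simps)
    also have "\<dots> = (c * b) *s isotropic t r (moebius r z2)"
      unfolding transfer_fun_isotropic[OF t norm_direction[OF r \<zeta>]]
      by (simp add: b_def z1_def z2_def vector_smult_assoc)
    also have "moebius r z2 = direction r \<zeta> e (2 * Suc n)"
      by (simp add: z1_def z2_def)
    finally have "Phi t r \<theta> \<alpha> l (Suc n) \<omega> *v isotropic t r \<zeta>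
      = (c * b) *s isotropic t r (direction r \<zeta> e (2 * Suc n))" .
    moreover have "norm b = exp (log_gain t r z1) * exp (log_gain t r z2)"
      using t z r by (simp add: exp_log_gain b_def norm_mult norm_divide)
    then have "norm (c * b) = exp (total_log_gain t r \<zeta> e (2 * Suc n))"
      by (simp add: norm_mult c(1) total_log_gain_def exp_add z1_def z2_def)
    ultimately show ?case by blast
  qed
  with that show thesis by blast
qed

text \<open>The product stretches an isotropic vector by the exponential of its total log gain, up
  to factors coming from lengths between \<open>t\<close> and \<open>3\<close>. One such vector
  bounds the norm from below; two that span the plane bound it from above.\<close>

lemma ln_onorm_tau_Phi_bounds:
  fixes \<theta> \<alpha> :: "int \<Rightarrow> 'a \<Rightarrow> real" and l :: real and \<omega> :: 'a and n :: nat
  assumes t: "0 < t" "t < 1" "r = sqrt (1 - t\<^sup>2)"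
  defines "L \<equiv> \<lambda>\<zeta>. total_log_gain t r \<zeta> (\<lambda>k. eta \<theta> \<alpha> l (int k + 1) \<omega>) (2 * n)"
  defines "K \<equiv> ln (onorm ((*v) (tau (Phi t r \<theta> \<alpha> l n \<omega>))))"
  shows "L 1 + ln (t / 3) \<le> K"
    and "K \<le> max (L 1) (L (- 1)) + ln (12 / t)"
proof -
  have r: "0 \<le> r" "r < 1"
    using t by (auto simp: real_sqrt_lt_1_iff power_le_one)
  define e where "e = (\<lambda>k. eta \<theta> \<alpha> l (int k + 1) \<omega>)"
  define A where "A = Phi t r \<theta> \<alpha> l n \<omega>"
  define k where "k = onorm ((*v) (tau A))"
  have iso: "t \<le> norm (isotropic t r z)" "norm (isotropic t r z) \<le> 3" if "norm z = 1" for z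
    using norm_isotropic_ge norm_isotropic_le t r that by auto
  have A: "exp (L z) * t \<le> norm (A *v isotropic t r z)"
    "norm (A *v isotropic t r z) \<le> exp (L z) * 3" if z: "norm z = 1" for z
  proof -
    obtain c where c: "norm c = exp (L z)" "A *v isotropic t r z = c *s isotropic t r (direction r z e (2 * n))"
      unfolding L_def A_def e_def by (rule Phi_isotropic[OF t z])
    have "norm (A *v isotropic t r z) = exp (L z) * norm (isotropic t r (direction r z e (2 * n)))"
      by (simp add: c norm_smult_cart)
    with iso[OF norm_direction[OF r z]]
    show "exp (L z) * t \<le> norm (A *v isotropic t r z)" "norm (A *v isotropic t r z) \<le> exp (L z) * 3"
      by auto
  qed
  have "0 \<le> k" unfolding k_def by (rule onorm_pos_le) simp
  have "exp (L 1) * t \<le> k * 3"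
    using A(1)[of 1] norm_le_onorm_tau[of A "isotropic t r 1"] mult_left_mono[OF iso(2)[of 1] \<open>0 \<le> k\<close>]
    unfolding k_def by simp
  then have le_k: "exp (L 1) * (t / 3) \<le> k" by simp
  moreover have pos: "0 < exp (L 1) * (t / 3)" using t by simp
  ultimately have k: "0 < k" by linarith
  have "ln (exp (L 1) * (t / 3)) \<le> ln k"
    using le_k pos k by (subst ln_le_cancel_iff)
  then show "L 1 + ln (t / 3) \<le> K"
    unfolding K_def A_def[symmetric] k_def[symmetric] using t(1,2) by (simp add: ln_mult ln_div)
  \<comment> \<open>The constant is \<open>2 * (2 / t) * 3\<close>: two spanning vectors,
    coefficients at most \<open>2 / t\<close>, lengths at most \<open>3\<close>.\<close>
  have "k \<le> exp (max (L 1) (L (- 1))) * (12 / t)"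
    unfolding k_def
  proof (rule onorm_tau_le)
    fix v
    obtain c d where v: "v = c *s isotropic t r 1 + d *s isotropic t r (- 1)"
      and cd: "norm c \<le> 2 / t * norm v" "norm d \<le> 2 / t * norm v"
      by (rule isotropic_span[OF t(1,2) r])
    have "norm (A *v v) = norm (c *s (A *v isotropic t r 1) + d *s (A *v isotropic t r (- 1)))"
      by (subst v) (simp add: matrix_vector_right_distrib vector_scalar_commute)
    also have "\<dots> \<le> norm c * norm (A *v isotropic t r 1) + norm d * norm (A *v isotropic t r (- 1))"
      by (rule order.trans[OF norm_triangle_ineq]) (simp add: norm_smult_cart)
    also have "\<dots> \<le> (2 / t * norm v) * (exp (max (L 1) (L (- 1))) * 3)
        + (2 / t * norm v) * (exp (max (L 1) (L (- 1))) * 3)"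
      using A(2)[of 1] A(2)[of "- 1"]
      by (intro add_mono mult_mono cd) (use t in \<open>auto elim!: order.trans\<close>)
    finally show "norm (A *v v) \<le> exp (max (L 1) (L (- 1))) * (12 / t) * norm v"
      by (simp add: mult_ac)
  qed
  then have "ln k \<le> ln (exp (max (L 1) (L (- 1))) * (12 / t))"
    using k t by (intro ln_mono) auto
  then show "K \<le> max (L 1) (L (- 1)) + ln (12 / t)"
    unfolding K_def A_def[symmetric] k_def[symmetric] using t(1,2) by (simp add: ln_mult ln_div)
qed

text \<open>After division by \<open>n\<close> the additive constants of the two bounds vanish and
  both sides have the same limit. The factor \<open>2\<close> appears because \<open>n\<close>
  matrices produce \<open>2 * n\<close> gains.\<close>

lemma tendsto_ln_onorm_Psi:
  assumes t: "0 < t" "t < 1" "r = sqrt (1 - t\<^sup>2)"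
    and lim: "\<And>\<zeta>. \<zeta> \<in> {1, - 1} \<Longrightarrow>
      (\<lambda>n. total_log_gain t r \<zeta> (\<lambda>k. eta \<theta> \<alpha> l (int k + 1) \<omega>) n / real n) \<longlonglongrightarrow> g"
  shows "(\<lambda>n. 1 / real n * ln (onorm ((*v) (Psi t r \<theta> \<alpha> l n \<omega>)))) \<longlonglongrightarrow> 2 * g"
proof -
  define L where "L \<zeta> n = total_log_gain t r \<zeta> (\<lambda>k. eta \<theta> \<alpha> l (int k + 1) \<omega>) (2 * n)" for \<zeta> n
  define K where "K n = ln (onorm ((*v) (tau (Phi t r \<theta> \<alpha> l n \<omega>))))" for n
  have bnd: "L 1 n + ln (t / 3) \<le> K n" "K n \<le> max (L 1 n) (L (- 1) n) + ln (12 / t)" for n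
    unfolding K_def L_def by (rule ln_onorm_tau_Phi_bounds[OF t])+
  have lim': "(\<lambda>n. L \<zeta> n / n) \<longlonglongrightarrow> 2 * g" if "\<zeta> \<in> {1, - 1}" for \<zeta>
  proof -
    have "(\<lambda>n. 2 * (L \<zeta> n / real (2 * n))) \<longlonglongrightarrow> 2 * g"
      unfolding L_def
      by (intro tendsto_mult_left filterlim_compose[OF lim[OF that], of "\<lambda>n. 2 * n"])
         (auto intro!: filterlim_subseq simp: strict_mono_def)
    then show ?thesis by simp
  qed
  have c: "(\<lambda>n. c / real n) \<longlonglongrightarrow> 0" for c :: real
    by (rule lim_const_over_n)
  have "(\<lambda>n. L 1 n / n + ln (t / 3) / n) \<longlonglongrightarrow> 2 * g + 0"
    by (intro tendsto_add lim' c) auto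
  moreover have "(\<lambda>n. max (L 1 n / n) (L (- 1) n / n) + ln (12 / t) / n) \<longlonglongrightarrow> max (2 * g) (2 * g) + 0"
    by (intro tendsto_add tendsto_max lim' c) auto
  moreover have "L 1 n / n + ln (t / 3) / n \<le> K n / n" for n
    using divide_right_mono[OF bnd(1)[of n], of "real n"] by (simp add: add_divide_distrib)
  moreover have "K n / n \<le> max (L 1 n / n) (L (- 1) n / n) + ln (12 / t) / n" for n
    using divide_right_mono[OF bnd(2)[of n], of "real n"]
    by (auto simp add: add_divide_distrib max_def divide_right_mono split: if_splits)
  ultimately have "(\<lambda>n. K n / n) \<longlonglongrightarrow> 2 * g"
    by (intro tendsto_sandwich[of "\<lambda>n. L 1 n / n + ln (t / 3) / n" "\<lambda>n. K n / n" _
          "\<lambda>n. max (L 1 n / n) (L (- 1) n / n) + ln (12 / t) / n"]) auto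
  then show ?thesis by (simp add: K_def Psi_def)
qed

section \<open>Rotation by a uniform angle\<close>

lemma borel_measurable_cis [measurable]: "cis \<in> borel_measurable borel"
  by (intro borel_measurable_continuous_onI continuous_intros)

lemma sets_uniform_torus [measurable_cong, simp]: "sets uniform_torus = sets borel"
  by (simp add: uniform_torus_def)

lemma space_uniform_torus [simp]: "space uniform_torus = UNIV"
  by (simp add: uniform_torus_def)

text \<open>Passing to the closed interval, which differs by a null set, connects the law with
  contour integrals and with integrability of continuous functions on compact intervals.\<close>

lemma uniform_torus_eq_density:
  "uniform_torus = density lborel (\<lambda>x. ennreal (indicator {0..2 * pi} x / (2 * pi)))"
  unfolding uniform_torus_def uniform_measure_def
proof (rule density_cong)
  have "AE x in lborel. x \<noteq> 2 * pi" by (rule AE_lborel_singleton)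
  then show "AE x in lborel. indicator {0..<2 * pi} x / emeasure lborel {0..<2 * pi}
      = ennreal (indicator {0..2 * pi} x / (2 * pi))"
    by eventually_elim (auto simp: indicator_def divide_ennreal[symmetric])
qed auto

lemma prob_space_uniform_torus: "prob_space uniform_torus"
  unfolding uniform_torus_def by (intro prob_space_uniform_measure) auto

text \<open>Substitution moves the window to \<open>{c..<c + p}\<close>; the piece beyond
  \<open>p\<close> is then carried back by one period.\<close>

lemma nn_integral_shift_periodic:
  fixes f :: "real \<Rightarrow> ennreal"
  assumes [measurable]: "f \<in> borel_measurable borel"
    and per: "\<And>x. f (x + p) = f x" and c: "0 \<le> c" "c \<le> p"
  shows "(\<integral>\<^sup>+x. f (x + c) * indicator {0..<p} x \<partial>lborel) = (\<integral>\<^sup>+x. f x * indicator {0..<p} x \<partial>lborel)"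
proof -
  have "(\<integral>\<^sup>+x. f (x + c) * indicator {0..<p} x \<partial>lborel) = (\<integral>\<^sup>+x. f x * indicator {c..<c + p} x \<partial>lborel)"
    by (subst nn_integral_real_affine[where c=1 and t=c, of "\<lambda>x. f x * indicator {c..<c + p} x"])
       (auto intro!: nn_integral_cong simp: indicator_def add_ac)
  also have "\<dots> = (\<integral>\<^sup>+x. f x * indicator {c..<p} x + f x * indicator {p..<c + p} x \<partial>lborel)"
    using c by (intro nn_integral_cong) (auto simp: indicator_def)
  also have "\<dots> = (\<integral>\<^sup>+x. f x * indicator {c..<p} x \<partial>lborel) + (\<integral>\<^sup>+x. f x * indicator {p..<c + p} x \<partial>lborel)"
    by (rule nn_integral_add) auto
  also have "(\<integral>\<^sup>+x. f x * indicator {p..<c + p} x \<partial>lborel) = (\<integral>\<^sup>+x. f x * indicator {0..<c} x \<partial>lborel)"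
    by (subst nn_integral_real_affine[where c=1 and t=p, of "\<lambda>x. f x * indicator {p..<c + p} x"])
       (auto intro!: nn_integral_cong simp: indicator_def per add.commute[of p])
  also have "(\<integral>\<^sup>+x. f x * indicator {c..<p} x \<partial>lborel) + \<dots>
      = (\<integral>\<^sup>+x. f x * indicator {c..<p} x + f x * indicator {0..<c} x \<partial>lborel)"
    by (rule nn_integral_add[symmetric]) auto
  also have "\<dots> = (\<integral>\<^sup>+x. f x * indicator {0..<p} x \<partial>lborel)"
    using c by (intro nn_integral_cong) (auto simp: indicator_def)
  finally show ?thesis .
qed

lemma nn_integral_uniform_torus_rotate:
  fixes f :: "complex \<Rightarrow> ennreal"
  assumes [measurable]: "f \<in> borel_measurable borel" and u: "norm u = 1"
  shows "(\<integral>\<^sup>+x. f (cis x * u) \<partial>uniform_torus) = (\<integral>\<^sup>+x. f (cis x) \<partial>uniform_torus)"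
proof -
  have u_eq: "u = cis (Arg2pi u)"
    using Arg2pi_eq[of u] u by (simp add: cis_conv_exp mult.commute)
  have "(\<integral>\<^sup>+x. f (cis (x + Arg2pi u)) * indicator {0..<2 * pi} x \<partial>lborel)
      = (\<integral>\<^sup>+x. f (cis x) * indicator {0..<2 * pi} x \<partial>lborel)"
    using Arg2pi_ge_0[of u] Arg2pi_lt_2pi[of u]
    by (intro nn_integral_shift_periodic[of "\<lambda>x. f (cis x)"]) (auto simp: cis_mult[symmetric])
  then show ?thesis
    unfolding uniform_torus_def
    by (subst (1 2) nn_integral_uniform_measure) (auto simp: cis_mult[symmetric] simp flip: u_eq)
qed

context prob_space
begin

text \<open>Fubini over the independent pair \<open>W\<close>, \<open>R\<close>: for each fixed
  value \<open>w\<close> of \<open>W\<close>, rotation by the unit number \<open>u w\<close>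
  preserves the uniform law, so the conditional law of the rotated point does not depend on
  \<open>w\<close>.\<close>

lemma
  fixes W R :: "'a \<Rightarrow> 'b" and \<phi> :: "'b \<Rightarrow> real" and u :: "'b \<Rightarrow> complex"
    and F :: "'b \<Rightarrow> 'c" and G :: "complex \<Rightarrow> 'c"
  assumes ind: "indep_var N W Q R"
    and [measurable]: "\<phi> \<in> borel_measurable Q"
    and unif: "distr M borel (\<lambda>\<omega>. \<phi> (R \<omega>)) = uniform_torus"
    and [measurable]: "u \<in> borel_measurable N" and u: "\<And>w. w \<in> space N \<Longrightarrow> norm (u w) = 1"
    and [measurable]: "G \<in> measurable borel T"
  shows distr_uniform_rotate:
      "distr M T (\<lambda>\<omega>. G (cis (\<phi> (R \<omega>)) * u (W \<omega>))) = distr uniform_torus T (\<lambda>x. G (cis x))"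
    and indep_var_uniform_rotate: "F \<in> measurable N S \<Longrightarrow>
      indep_var S (\<lambda>\<omega>. F (W \<omega>)) T (\<lambda>\<omega>. G (cis (\<phi> (R \<omega>)) * u (W \<omega>)))"
proof -
  have W [measurable]: "W \<in> measurable M N" and R [measurable]: "R \<in> measurable M Q"
    and pair: "distr M N W \<Otimes>\<^sub>M distr M Q R = distr M (N \<Otimes>\<^sub>M Q) (\<lambda>\<omega>. (W \<omega>, R \<omega>))"
    using ind unfolding indep_var_distribution_eq by auto
  interpret U: prob_space uniform_torus by (rule prob_space_uniform_torus)
  interpret DR: prob_space "distr M Q R" by (rule prob_space_distr) fact
  define Z where "Z \<omega> = G (cis (\<phi> (R \<omega>)) * u (W \<omega>))" for \<omega>
  define C where "C = distr uniform_torus T (\<lambda>x. G (cis x))"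
  interpret C: prob_space C unfolding C_def by (rule U.prob_space_distr) simp
  have Z [measurable]: "Z \<in> measurable M T" unfolding Z_def by measurable
  \<comment> \<open>This product formula serves twice: \<open>A = space N\<close> gives the law of
    \<open>Z\<close>, and preimages under \<open>F\<close> give independence.\<close>
  have rect: "(\<integral>\<^sup>+\<omega>. indicator A (W \<omega>) * indicator B (Z \<omega>) \<partial>M) = emeasure (distr M N W) A * emeasure C B"
    if A [measurable]: "A \<in> sets N" and B [measurable]: "B \<in> sets T" for A B
  proof -
    have "(\<integral>\<^sup>+\<omega>. indicator A (W \<omega>) * indicator B (Z \<omega>) \<partial>M)
      = (\<integral>\<^sup>+p. indicator A (fst p) * indicator B (G (cis (\<phi> (snd p)) * u (fst p)))
        \<partial>distr M (N \<Otimes>\<^sub>M Q) (\<lambda>\<omega>. (W \<omega>, R \<omega>)))"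
      by (subst nn_integral_distr) (auto simp: Z_def)
    also have "\<dots> = (\<integral>\<^sup>+w. \<integral>\<^sup>+p. indicator A w * indicator B (G (cis (\<phi> p) * u w)) \<partial>distr M Q R \<partial>distr M N W)"
      unfolding pair[symmetric]
      by (subst DR.nn_integral_fst[symmetric]) auto
    also have "\<dots> = (\<integral>\<^sup>+w. indicator A w * emeasure C B \<partial>distr M N W)"
    proof (rule nn_integral_cong)
      fix w assume w: "w \<in> space (distr M N W)"
      have "(\<integral>\<^sup>+p. indicator B (G (cis (\<phi> p) * u w)) \<partial>distr M Q R)
          = (\<integral>\<^sup>+x. indicator B (G (cis x * u w)) \<partial>distr M borel (\<lambda>\<omega>. \<phi> (R \<omega>)))"
        by (simp add: nn_integral_distr)
      also have "\<dots> = (\<integral>\<^sup>+x. indicator B (G (cis x)) \<partial>uniform_torus)"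
        unfolding unif using w u
        by (intro nn_integral_uniform_torus_rotate[of "\<lambda>z. indicator B (G z)"]) auto
      also have "\<dots> = emeasure C B"
        unfolding C_def by (subst nn_integral_indicator[symmetric], simp, subst nn_integral_distr) auto
      finally show "(\<integral>\<^sup>+p. indicator A w * indicator B (G (cis (\<phi> p) * u w)) \<partial>distr M Q R)
          = indicator A w * emeasure C B"
        by (subst nn_integral_cmult) auto
    qed
    also have "\<dots> = emeasure (distr M N W) A * emeasure C B"
      by (subst nn_integral_multc) auto
    finally show ?thesis .
  qed
  have Z_C: "distr M T Z = C"
  proof (rule measure_eqI)
    fix B assume "B \<in> sets (distr M T Z)"
    then have B [measurable]: "B \<in> sets T" by simp
    have "emeasure (distr M T Z) B = (\<integral>\<^sup>+\<omega>. indicator (space N) (W \<omega>) * indicator B (Z \<omega>) \<partial>M)"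
      using measurable_space[OF W]
      by (subst nn_integral_indicator[symmetric], simp, subst nn_integral_distr)
         (auto intro!: nn_integral_cong)
    also have "\<dots> = emeasure C B"
      using prob_space.emeasure_space_1[OF prob_space_distr[OF W]] by (subst rect) auto
    finally show "emeasure (distr M T Z) B = emeasure C B" .
  qed (simp add: C_def)
  then show "distr M T (\<lambda>\<omega>. G (cis (\<phi> (R \<omega>)) * u (W \<omega>))) = distr uniform_torus T (\<lambda>x. G (cis x))"
    by (simp add: Z_def[abs_def] C_def)
  assume F [measurable]: "F \<in> measurable N S"
  have FW: "(\<lambda>\<omega>. F (W \<omega>)) \<in> measurable M S" by measurable
  have "distr M S (\<lambda>\<omega>. F (W \<omega>)) \<Otimes>\<^sub>M distr M T Z = distr M (S \<Otimes>\<^sub>M T) (\<lambda>\<omega>. (F (W \<omega>), Z \<omega>))"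
  proof (rule pair_measure_eqI)
    fix A B assume "A \<in> sets (distr M S (\<lambda>\<omega>. F (W \<omega>)))" "B \<in> sets (distr M T Z)"
    then have A [measurable]: "A \<in> sets S" and B [measurable]: "B \<in> sets T" by auto
    have "emeasure (distr M S (\<lambda>\<omega>. F (W \<omega>))) A = emeasure (distr M N W) (F -` A \<inter> space N)"
      using measurable_space[OF W]
      by (subst (1 2) emeasure_distr) (auto intro!: arg_cong[where f="emeasure M"])
    then have "emeasure (distr M S (\<lambda>\<omega>. F (W \<omega>))) A * emeasure (distr M T Z) B
        = (\<integral>\<^sup>+\<omega>. indicator (F -` A \<inter> space N) (W \<omega>) * indicator B (Z \<omega>) \<partial>M)"
      unfolding Z_C by (subst rect) auto
    also have "\<dots> = (\<integral>\<^sup>+\<omega>. indicator (A \<times> B) (F (W \<omega>), Z \<omega>) \<partial>M)"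
      using measurable_space[OF W] by (auto intro!: nn_integral_cong simp: indicator_def)
    also have "\<dots> = emeasure (distr M (S \<Otimes>\<^sub>M T) (\<lambda>\<omega>. (F (W \<omega>), Z \<omega>))) (A \<times> B)"
      by (subst nn_integral_indicator[symmetric], simp, subst nn_integral_distr) auto
    finally show "emeasure (distr M S (\<lambda>\<omega>. F (W \<omega>))) A * emeasure (distr M T Z) B
        = emeasure (distr M (S \<Otimes>\<^sub>M T) (\<lambda>\<omega>. (F (W \<omega>), Z \<omega>))) (A \<times> B)" .
  next
    show "sets (distr M S (\<lambda>\<omega>. F (W \<omega>)) \<Otimes>\<^sub>M distr M T Z)
        = sets (distr M (S \<Otimes>\<^sub>M T) (\<lambda>\<omega>. (F (W \<omega>), Z \<omega>)))"
      by (simp cong: sets_pair_measure_cong)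
  qed (auto intro!: prob_space_imp_sigma_finite prob_space_distr FW Z)
  then show "indep_var S (\<lambda>\<omega>. F (W \<omega>)) T (\<lambda>\<omega>. G (cis (\<phi> (R \<omega>)) * u (W \<omega>)))"
    unfolding indep_var_distribution_eq Z_def[symmetric] using FW Z by auto
qed

end

text \<open>Mean value property of \<open>Ln (1 - a * w)\<close>, which is zero at the centre. The
  assumption \<open>norm a < 1\<close> keeps \<open>1 - a * w\<close> in the right half plane on the
  closed disc, away from the branch cut.\<close>

lemma has_integral_ln_norm_one_minus:
  assumes a: "norm a < 1"
  shows "((\<lambda>x. ln (norm (1 - a * cis x))) has_integral 0) {0..2 * pi}"
proof -
  have pos: "0 < Re (1 - a * w)" if "norm w \<le> 1" for w
  proof -
    have "norm (a * w) < 1"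
      using a that mult_mono[of "norm a" "norm a" "norm w" 1] by (simp add: norm_mult)
    then show ?thesis using complex_Re_le_cmod[of "a * w"] by simp
  qed
  have "(\<lambda>w. Ln (1 - a * w)) holomorphic_on cball 0 1"
    using pos by (intro holomorphic_intros) (fastforce simp: complex_nonpos_Reals_iff)
  then have "((\<lambda>w. Ln (1 - a * w) / (w - 0)) has_contour_integral 2 * of_real pi * \<i> * Ln (1 - a * 0)) (circlepath 0 1)"
    by (intro Cauchy_integral_circlepath_simple) auto
  then have "((\<lambda>w. Ln (1 - a * w) / w) has_contour_integral 0) (part_circlepath 0 1 0 (2 * pi))"
    by (simp add: circlepath_def)
  \<comment> \<open>On the unit circle \<open>dw / w\<close> equals \<open>i dx\<close>, so the real
    part of \<open>Ln\<close> is the imaginary part of this integrand.\<close>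
  then have "((\<lambda>x. \<i> * Ln (1 - a * cis x)) has_integral 0) {0..2 * pi}"
    by (subst (asm) has_contour_integral_part_circlepath_iff) (auto simp: mult_ac)
  from has_integral_Im[OF this]
  have "((\<lambda>x. Re (Ln (1 - a * cis x))) has_integral 0) {0..2 * pi}"
    by simp
  moreover have "Re (Ln (1 - a * cis x)) = ln (norm (1 - a * cis x))" for x
    using pos[of "cis x"] by (intro Re_Ln) (metis less_irrefl norm_cis order_refl zero_complex.sel(1))
  ultimately show ?thesis by simp
qed

lemma integral_log_gain:
  assumes "0 < t" "0 \<le> r" "r < 1"
  shows "(\<integral>x. log_gain t r (cis x) \<partial>uniform_torus) = ln (1 / t)"
proof -
  let ?f = "\<lambda>x. ln (norm (1 - \<i> * of_real r * cis x))"
  interpret U: prob_space uniform_torus by (rule prob_space_uniform_torus)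
  have g: "0 < norm (1 - \<i> * of_real r * cis x)" for x
    by (rule less_le_trans[OF _ one_minus_r_le_gain]) (use assms in auto)
  have eq: "log_gain t r (cis x) = ?f x + ln (1 / t)" for x
    unfolding log_gain_def using g[of x] assms by (simp add: ln_div)
  have "continuous_on {0..2 * pi} ?f"
    using g by (intro continuous_intros) auto
  then have int: "set_integrable lborel {0..2 * pi} ?f"
    by (rule borel_integrable_atLeastAtMost')
  have "(LINT x:{0..2 * pi}|lborel. ?f x) = integral {0..2 * pi} ?f"
    by (rule set_borel_integral_eq_integral(2)[OF int])
  also have "\<dots> = 0"
    using has_integral_ln_norm_one_minus[of "\<i> * of_real r"] assms
    by (intro integral_unique) (simp add: norm_mult)
  finally have zero: "(LINT x:{0..2 * pi}|lborel. ?f x) = 0" .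
  have "(\<integral>x. ?f x \<partial>uniform_torus) = (\<integral>x. (indicator {0..2 * pi} x *\<^sub>R ?f x) / (2 * pi) \<partial>lborel)"
    unfolding uniform_torus_eq_density by (subst integral_density) auto
  also have "\<dots> = 0"
    using zero by (simp add: set_lebesgue_integral_def)
  finally have "(\<integral>x. ?f x \<partial>uniform_torus) = 0" .
  moreover have "integrable uniform_torus ?f"
    unfolding uniform_torus_eq_density
    using integrable_divide[OF int[unfolded set_integrable_def], of "2 * pi"]
    by (subst integrable_density) auto
  ultimately show ?thesis by (simp add: eq U.prob_space[simplified])
qed

section \<open>The Lyapunov exponent\<close>

lemma total_log_gain_cong:
  assumes "\<And>k. k < n \<Longrightarrow> e k = e' k"
  shows "total_log_gain t r \<zeta> e n = total_log_gain t r \<zeta> e' n"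
  unfolding total_log_gain_def
proof (rule sum.cong)
  fix k assume "k \<in> {..<n}"
  then have "direction r \<zeta> e k = direction r \<zeta> e' k" "e k = e' k"
    using assms by (auto intro: direction_cong)
  then show "log_gain t r (cis (e k) * direction r \<zeta> e k) = log_gain t r (cis (e' k) * direction r \<zeta> e' k)"
    by simp
qed simp

lemma borel_measurable_moebius [measurable]: "moebius r \<in> borel_measurable borel"
  unfolding moebius_def[abs_def] by measurable

lemma borel_measurable_log_gain [measurable]: "log_gain t r \<in> borel_measurable borel"
  unfolding log_gain_def[abs_def] by measurable

lemma borel_measurable_direction:
  assumes "\<And>k. k < n \<Longrightarrow> (\<lambda>x. e x k) \<in> borel_measurable N"
  shows "(\<lambda>x. direction r \<zeta> (e x) n) \<in> borel_measurable N"
  using assms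
proof (induction n)
  case (Suc n)
  have [measurable]: "(\<lambda>x. direction r \<zeta> (e x) n) \<in> borel_measurable N" "(\<lambda>x. e x n) \<in> borel_measurable N"
    using Suc by auto
  show ?case by simp
qed simp

lemma borel_measurable_total_log_gain:
  assumes "\<And>k. k < n \<Longrightarrow> (\<lambda>x. e x k) \<in> borel_measurable N"
  shows "(\<lambda>x. total_log_gain t r \<zeta> (e x) n) \<in> borel_measurable N"
  unfolding total_log_gain_def
proof (rule borel_measurable_sum)
  fix k assume k: "k \<in> {..<n}"
  have [measurable]: "(\<lambda>x. direction r \<zeta> (e x) k) \<in> borel_measurable N" "(\<lambda>x. e x k) \<in> borel_measurable N"
    using k assms by (auto intro: borel_measurable_direction)
  show "(\<lambda>x. log_gain t r (cis (e x k) * direction r \<zeta> (e x) k)) \<in> borel_measurable N"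
    by measurable
qed

text \<open>
  The angle \<open>\<theta> (n + 1)\<close> does not occur in the first \<open>n\<close> gains, so even conditionally on all the
  other angles it makes the rotated direction at step \<open>n\<close> uniform on the circle.
\<close>

lemma (in prob_space) AE_total_log_gain_average:
  assumes t: "0 < t" and r: "0 \<le> r" "r < 1" and \<zeta>: "norm \<zeta> = 1"
    and ind: "indep_vars (\<lambda>_. borel) (case_sum \<theta> \<alpha>) (UNIV :: (int + int) set)"
    and unif: "\<And>k. distr M borel (\<theta> k) = uniform_torus"
  shows "AE \<omega> in M. (\<lambda>n. total_log_gain t r \<zeta> (\<lambda>k. eta \<theta> \<alpha> l (int k + 1) \<omega>) n / real n) \<longlonglongrightarrow> ln (1 / t)"
proof -
  define X where "X = case_sum \<theta> \<alpha>"
  define e where "e \<omega> k = eta \<theta> \<alpha> l (int k + 1) \<omega>" for \<omega> k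
  \<comment> \<open>The same angles, read off a point \<open>p\<close> of the product space instead
    of \<open>\<omega>\<close>; the past can then be written as a function of the coordinates other
    than the fresh one.\<close>
  define E where "E p k = eta (\<lambda>j p. p (Inl j)) (\<lambda>j p. p (Inr j)) l (int k + 1) p"
    for p :: "int + int \<Rightarrow> real" and k :: nat
  define Y where "Y n \<omega> = log_gain t r (cis (e \<omega> n) * direction r \<zeta> (e \<omega>) n) - ln (1 / t)" for n \<omega>
  have Y_sum: "(\<Sum>k<n. Y k \<omega>) = total_log_gain t r \<zeta> (e \<omega>) n - n * ln (1 / t)" for n \<omega>
    by (simp add: Y_def total_log_gain_def sum_subtractf)
  have X_meas: "X i \<in> borel_measurable M" for i
    using ind by (auto simp: X_def indep_vars_def)
  have \<theta>\<alpha> [measurable]: "\<theta> k \<in> borel_measurable M" "\<alpha> k \<in> borel_measurable M" for k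
    using X_meas[of "Inl k"] X_meas[of "Inr k"] by (auto simp: X_def)
  have [measurable]: "(\<lambda>\<omega>. e \<omega> k) \<in> borel_measurable M" for k
    unfolding e_def eta_def by measurable
  have [measurable]: "(\<lambda>\<omega>. direction r \<zeta> (e \<omega>) n) \<in> borel_measurable M" for n
    by (rule borel_measurable_direction) simp
  have Y_meas: "Y n \<in> borel_measurable M" for n
    unfolding Y_def by measurable
  have Y_bd: "\<bar>Y n \<omega>\<bar> \<le> \<bar>ln ((1 - r) / t)\<bar> + \<bar>ln ((1 + r) / t)\<bar> + \<bar>ln (1 / t)\<bar>" for n \<omega>
    using abs_log_gain_le[OF t r, of "cis (e \<omega> n) * direction r \<zeta> (e \<omega>) n"] norm_direction[OF r \<zeta>]
    unfolding Y_def by (auto simp: norm_mult intro: order.trans[OF abs_triangle_ineq4])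
  have Y: "expectation (Y n) = 0 \<and> indep_var borel (\<lambda>\<omega>. \<Sum>k<n. Y k \<omega>) borel (Y n)" for n
  proof -
    \<comment> \<open>The fresh angle is \<open>\<theta> (n + 1)\<close>:
      \<open>e \<omega> k\<close> involves indices \<open>k\<close> and \<open>k + 1\<close>, so it
      first occurs in \<open>e \<omega> n\<close>. The angle \<open>\<alpha> (n + 1)\<close> stays
      among the coordinates of \<open>W\<close>.\<close>
    define i :: "int + int" where "i = Inl (int n + 1)"
    define N Q where "N = PiM (- {i}) (\<lambda>_. borel :: real measure)"
      and "Q = PiM {i} (\<lambda>_. borel :: real measure)"
    define W R where "W \<omega> = restrict (\<lambda>j. X j \<omega>) (- {i})" and "R \<omega> = restrict (\<lambda>j. X j \<omega>) {i}" for \<omega>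
    define \<phi> where "\<phi> p = p i" for p :: "int + int \<Rightarrow> real"
    \<comment> \<open>Everything in the rotated direction at step \<open>n\<close> except the fresh
      angle: the other four terms of \<open>e \<omega> n\<close> and the direction reached so
      far.\<close>
    define u where "u p = cis (p (Inl (int n)) + p (Inr (int n + 1)) - p (Inr (int n)) + l)
      * direction r \<zeta> (E p) n" for p
    define F where "F p = total_log_gain t r \<zeta> (E p) n - n * ln (1 / t)" for p
    define G where "G z = log_gain t r z - ln (1 / t)" for z
    have WR: "indep_var N W Q R"
      using indep_var_restrict[OF ind, of "- {i}" "{i}"]
      unfolding N_def Q_def W_def R_def X_def by simp
    have \<phi>: "\<phi> \<in> borel_measurable Q"
      unfolding Q_def \<phi>_def by (rule measurable_component_singleton) simp
    have \<phi>R: "\<phi> (R \<omega>) = \<theta> (int n + 1) \<omega>" for \<omega>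
      by (simp add: \<phi>_def R_def X_def i_def)
    have comp: "(\<lambda>p. p j) \<in> borel_measurable N" if "j \<noteq> i" for j
      unfolding N_def using that by (intro measurable_component_singleton) simp
    have E_meas: "(\<lambda>p. E p k) \<in> borel_measurable N" if "k < n" for k
      unfolding E_def eta_def using that
      by (intro borel_measurable_add borel_measurable_diff comp borel_measurable_const) (auto simp: i_def)
    have E_W: "E (W \<omega>) k = e \<omega> k" if "k < n" for k \<omega>
      using that by (auto simp: E_def e_def eta_def W_def X_def i_def)
    have [measurable]: "(\<lambda>p. direction r \<zeta> (E p) n) \<in> borel_measurable N"
      by (rule borel_measurable_direction) (rule E_meas)
    have u_meas: "u \<in> borel_measurable N"
    proof -
      have [measurable]: "(\<lambda>p. p (Inl (int n))) \<in> borel_measurable N"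
        "(\<lambda>p. p (Inr (int n + 1))) \<in> borel_measurable N" "(\<lambda>p. p (Inr (int n))) \<in> borel_measurable N"
        by (auto intro!: comp simp: i_def)
      show ?thesis unfolding u_def by measurable
    qed
    have u: "norm (u p) = 1" for p
      unfolding u_def using norm_direction[OF r \<zeta>] by (simp add: norm_mult)
    have F_meas: "F \<in> borel_measurable N"
      unfolding F_def by (intro borel_measurable_diff borel_measurable_total_log_gain E_meas) auto
    have G_meas: "G \<in> borel_measurable borel"
      unfolding G_def by measurable
    have F_W: "F (W \<omega>) = (\<Sum>k<n. Y k \<omega>)" for \<omega>
      unfolding Y_sum F_def using total_log_gain_cong[of n "E (W \<omega>)" "e \<omega>"] E_W by simp
    have "cis (\<phi> (R \<omega>)) * u (W \<omega>) = cis (e \<omega> n) * direction r \<zeta> (e \<omega>) n" for \<omega>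
    proof -
      have "direction r \<zeta> (E (W \<omega>)) n = direction r \<zeta> (e \<omega>) n"
        by (rule direction_cong) (rule E_W)
      moreover have "e \<omega> n = \<phi> (R \<omega>) + (W \<omega> (Inl (int n)) + W \<omega> (Inr (int n + 1)) - W \<omega> (Inr (int n)) + l)"
        unfolding \<phi>R by (simp add: e_def eta_def W_def X_def i_def)
      ultimately show ?thesis
        by (simp add: u_def cis_mult[symmetric] mult.assoc)
    qed
    then have G_Y: "G (cis (\<phi> (R \<omega>)) * u (W \<omega>)) = Y n \<omega>" for \<omega>
      by (simp add: G_def Y_def)
    have unif': "distr M borel (\<lambda>\<omega>. \<phi> (R \<omega>)) = uniform_torus"
      using unif[of "int n + 1"] by (simp add: \<phi>R)
    have dist: "distr M borel (Y n) = distr uniform_torus borel (\<lambda>x. G (cis x))"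
      using distr_uniform_rotate[OF WR \<phi> unif' u_meas u G_meas] by (simp add: G_Y)
    have "indep_var borel (\<lambda>\<omega>. \<Sum>k<n. Y k \<omega>) borel (Y n)"
      using indep_var_uniform_rotate[OF WR \<phi> unif' u_meas u G_meas F_meas] by (simp add: F_W G_Y)
    moreover have "expectation (Y n) = 0"
    proof -
      interpret U: prob_space uniform_torus by (rule prob_space_uniform_torus)
      have int: "integrable uniform_torus (\<lambda>x. log_gain t r (cis x))"
        by (rule U.integrable_const_bound[where B="\<bar>ln ((1 - r) / t)\<bar> + \<bar>ln ((1 + r) / t)\<bar>"])
           (use abs_log_gain_le[OF t r] in auto)
      have "expectation (Y n) = (\<integral>x. x \<partial>distr M borel (Y n))"
        by (simp add: integral_distr Y_meas)
      also have "\<dots> = (\<integral>x. G (cis x) \<partial>uniform_torus)"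
        unfolding dist using G_meas by (subst integral_distr) auto
      also have "\<dots> = 0"
        unfolding G_def using integral_log_gain[OF t r] int by (simp add: U.prob_space[simplified])
      finally show ?thesis .
    qed
    ultimately show ?thesis by simp
  qed
  have "AE \<omega> in M. (\<lambda>n. (\<Sum>k<n. Y k \<omega>) / real n) \<longlonglongrightarrow> 0"
    using Y Y_bd Y_meas by (intro AE_average_tendsto_0) auto
  then show ?thesis
  proof eventually_elim
    case (elim \<omega>)
    then have "(\<lambda>n. (\<Sum>k<n. Y k \<omega>) / real n + ln (1 / t)) \<longlonglongrightarrow> 0 + ln (1 / t)"
      by (intro tendsto_intros)
    moreover have "\<forall>\<^sub>F n in sequentially. (\<Sum>k<n. Y k \<omega>) / real n + ln (1 / t) = total_log_gain t r \<zeta> (e \<omega>) n / real n"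
      using eventually_gt_at_top[of 0] by eventually_elim (simp add: Y_sum diff_divide_distrib)
    ultimately show ?case
      unfolding e_def by (simp add: tendsto_cong)
  qed
qed

theorem proposition5p4:
  fixes M :: "'a measure"
    and \<theta> \<alpha> :: "int \<Rightarrow> 'a \<Rightarrow> real"
    and t r l :: real
  assumes "prob_space M"
    and "0 < t" and "t < 1" and "r = sqrt (1 - t\<^sup>2)"
    and "prob_space.indep_vars M (\<lambda>_. borel) (case_sum \<theta> \<alpha>) (UNIV :: (int + int) set)"
    and "\<And>k. distr M borel (\<theta> k) = uniform_torus"
    and "\<And>k. distr M borel (\<alpha> k) = uniform_torus"
  shows "has_largest_lyapunov_exponent M (Psi t r \<theta> \<alpha> l)
           (largest_lyapunov_exponent M (Psi t r \<theta> \<alpha> l))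
         \<and> largest_lyapunov_exponent M (Psi t r \<theta> \<alpha> l) > 0"
proof -
  interpret prob_space M by fact
  note t = assms(2-4)
  have r: "0 \<le> r" "r < 1"
    using t by (auto simp: real_sqrt_lt_1_iff power_le_one)
  have lim: "AE \<omega> in M. (\<lambda>n. total_log_gain t r \<zeta> (\<lambda>k. eta \<theta> \<alpha> l (int k + 1) \<omega>) n / real n) \<longlonglongrightarrow> ln (1 / t)"
    if "\<zeta> \<in> {1, - 1}" for \<zeta>
    using that assms(5,6) by (intro AE_total_log_gain_average t(1) r) auto
  \<comment> \<open>The limit is established with an explicit value, on the intersection of the full
    measure events for the starting points \<open>1\<close> and \<open>- 1\<close>; uniqueness of
    almost sure limits then evaluates the description operator.\<close>
  have "has_largest_lyapunov_exponent M (Psi t r \<theta> \<alpha> l) (2 * ln (1 / t))"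
    unfolding has_largest_lyapunov_exponent_def
    using lim[OF insertI1] lim[OF insertI2, OF singletonI]
    by eventually_elim (rule tendsto_ln_onorm_Psi[OF t], auto)
  moreover from this have "largest_lyapunov_exponent M (Psi t r \<theta> \<alpha> l) = 2 * ln (1 / t)"
    by (rule largest_lyapunov_exponent_eqI)
  moreover have "0 < ln (1 / t)" using t by (intro ln_gt_zero) simp
  ultimately show ?thesis by simp
qed

end
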